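(* Let $d\ge1$, let $\phi:[0,1)^d\to\mathbb{R}$ be measurable, let $X=\phi(\bm u)$ with $\bm u$ uniformly distributed on $[0,1)^d$, let $F$ be the cumulative distribution function of $X$, let $p\in(0,1)$ and $v=\inf\{x\in\mathbb{R}:F(x)\ge p\}$. Put $\Omega_x=\{\bm u\in[0,1)^d:\phi(\bm u)\le x\}$. Assume: (A) $X$ has a density $f_X$ in a neighborhood of $v$, and $f_X$ is positive and continuous at $v$. (B) There exist a positive nondecreasing function $g(\epsilon)$, defined for $\epsilon>0$, with $\lim_{\epsilon\to0_+}g(\epsilon)=0$, and constants $\delta,\epsilon_0>0$ such that $$\sup_{x:\,|x-v|\le\delta}\lambda_d\big((\partial\Omega_x)_\epsilon\big)\le g(\epsilon)\quad\text{for every }0<\epsilon\le\epsilon_0.$$ Let $b\ge2$ and $t\ge0$ be integers, and for $m\ge t$ let $N=b^m$ and let $\{\bm u_1,\dots,\bm u_N\}$ be a $(t,m,d)$-net in base $b$. Let $\hat F_N(x)=\frac1N\sum_{i=1}^N\bm 1\{\phi(\bm u_i)\le x\}$ and $\hat v_N=\inf\{x\in\mathbb{R}:\hat F_N(x)\ge p\}$. Then, for $N$ large enough, $$|\hat v_N-v|\le\frac{2\,g\big(\sqrt d\,b^{1+t/d}N^{-1/d}\big)}{f_X(v)}.$$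
   Context: $\lambda_d$ is Lebesgue measure on $\mathbb{R}^d$, and $\partial\Omega$ is the topological boundary in $\mathbb{R}^d$. For $A\subset\mathbb{R}^d$ and $\epsilon>0$, the outer parallel body is $(A)_\epsilon=\{\bm x\in\mathbb{R}^d:\|\bm x-\bm y\|_2\le\epsilon\text{ for some }\bm y\in A\}$ (Euclidean norm), with $(\varnothing)_\epsilon=\varnothing$. "$X$ has a density $f_X$ in a neighborhood of $v$" means that on some open interval $J\ni v$ one has $F(y)-F(x)=\int_x^y f_X(s)\,ds$ for $x<y$ in $J$. An elementary interval in base $b$ is a set $\prod_{j=1}^d\big[t_jb^{-k_j},(t_j+1)b^{-k_j}\big)$ with integers $k_j\ge0$ and $0\le t_j<b^{k_j}$; its volume is $b^{-\sum_j k_j}$. For integers $0\le t\le m$, a $(t,m,d)$-net in base $b$ is a set of $b^m$ points (counted with multiplicity) in $[0,1)^d$ such that every elementary interval in base $b$ of volume $b^{t-m}$ contains exactly $b^t$ of the points. *)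

theory Defs
  imports "HOL-Probability.Probability"
begin

definition unit_cube :: "(real ^ 'd) set" where
  "unit_cube = {u. \<forall>j. 0 \<le> u $ j \<and> u $ j < 1}"

definition parallel_body :: "(real ^ 'd) set \<Rightarrow> real \<Rightarrow> (real ^ 'd) set" where
  "parallel_body A \<epsilon> = {x. \<exists>y\<in>A. norm (x - y) \<le> \<epsilon>}"

definition sublevel :: "(real ^ 'd \<Rightarrow> real) \<Rightarrow> real \<Rightarrow> (real ^ 'd) set" where
  "sublevel \<phi> x = {u \<in> unit_cube. \<phi> u \<le> x}"

text \<open>The restriction of Lebesgue measure to the unit cube has total mass one, so it is the
  uniform distribution there, and its image under \<open>\<phi>\<close> is the law of \<open>\<phi>(u)\<close> for a uniformly
  distributed \<open>u\<close>. The values of \<open>\<phi>\<close> outside the cube play no role.\<close>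

definition output_law :: "(real ^ 'd \<Rightarrow> real) \<Rightarrow> real measure" where
  "output_law \<phi> = distr (lebesgue_on unit_cube) borel \<phi>"

definition quantile :: "(real \<Rightarrow> real) \<Rightarrow> real \<Rightarrow> real" where
  "quantile F p = Inf {x. p \<le> F x}"

definition has_density_near :: "(real \<Rightarrow> real) \<Rightarrow> (real \<Rightarrow> real) \<Rightarrow> real \<Rightarrow> bool" where
  "has_density_near F f v \<longleftrightarrow>
     (\<exists>a c. a < v \<and> v < c \<and>
        (\<forall>x y. a < x \<and> x < y \<and> y < c \<longrightarrow>
           set_integrable lebesgue {x..y} f \<and>
           F y - F x = (LINT s:{x..y}|lebesgue. f s)))"

definition elementary_interval :: "nat \<Rightarrow> (real ^ 'd) set \<Rightarrow> bool" where
  "elementary_interval b E \<longleftrightarrow>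
     (\<exists>(k :: 'd \<Rightarrow> nat) (a :: 'd \<Rightarrow> nat). (\<forall>j. a j < b ^ k j) \<and>
        E = {x. \<forall>j. real (a j) / real b ^ k j \<le> x $ j \<and>
                     x $ j < (real (a j) + 1) / real b ^ k j})"

text \<open>The points are \<open>u 1, \<dots>, u (b ^ m)\<close>; counting indices counts points with multiplicity.\<close>

definition tms_net :: "nat \<Rightarrow> nat \<Rightarrow> nat \<Rightarrow> (nat \<Rightarrow> real ^ 'd) \<Rightarrow> bool" where
  "tms_net b t m u \<longleftrightarrow>
     t \<le> m \<and>
     (\<forall>i\<in>{1..b ^ m}. u i \<in> unit_cube) \<and>
     (\<forall>E. elementary_interval b E \<and> measure lebesgue E = real b powi (int t - int m) \<longrightarrow>
          card {i \<in> {1..b ^ m}. u i \<in> E} = b ^ t)"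

definition empirical_cdf ::
  "(real ^ 'd \<Rightarrow> real) \<Rightarrow> nat \<Rightarrow> (nat \<Rightarrow> real ^ 'd) \<Rightarrow> real \<Rightarrow> real" where
  "empirical_cdf \<phi> N u x = (\<Sum>i = 1..N. of_bool (\<phi> (u i) \<le> x)) / real N"

end

theory Submission imports Defs begin

text \<open>Cut the cube into cells of volume \<open>b\<^sup>t\<^sup>-\<^sup>m\<close> whose exponents \<open>k j\<close> are as equal as possible. Each
  cell has diameter at most \<open>sqrt d * b powr (1 - (m - t) / d)\<close>, which is the argument \<open>\<epsilon>\<close> of \<open>g\<close> in the
  theorem. The net is exact on every cell, so for \<open>x\<close> near \<open>v\<close> the empirical and true distribution
  functions at \<open>x\<close> differ by at most the volume of the cells cut by the boundary of \<open>\<Omega>\<^sub>x\<close>, hence by at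
  most \<open>g \<epsilon>\<close>. Near \<open>v\<close> the density exceeds \<open>2/3 * f v\<close>, so at distance \<open>2 * g \<epsilon> / f v\<close> from \<open>v\<close> the
  function \<open>F\<close> has moved away from \<open>p\<close> by more than \<open>g \<epsilon>\<close>, and these two points enclose the empirical
  quantile.\<close>

section \<open>Grid cells in the unit cube: measure, partition, diameter\<close>

text \<open>The set in \<open>elementary_interval\<close> with its parameters exposed: a fixed
  \<open>k\<close> gives a grid whose cells are indexed by \<open>a\<close>. The range of
  \<open>a\<close> is left to the lemmas that sum over the grid.\<close>

definition cell :: "nat \<Rightarrow> ('d \<Rightarrow> nat) \<Rightarrow> ('d \<Rightarrow> nat) \<Rightarrow> (real ^ 'd) set" where
  "cell b k a = {x. \<forall>j. real (a j) / real b ^ k j \<le> x $ j \<and>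
                         x $ j < (real (a j) + 1) / real b ^ k j}"

text \<open>The set is squeezed between \<open>box l r\<close> and \<open>cbox l r\<close>, which
  have the same measure.\<close>

lemma half_open_box_lebesgue:
  fixes l r :: "real ^ 'd"
  assumes lr: "\<And>j. l $ j \<le> r $ j"
  defines "E \<equiv> {x. \<forall>j. l $ j \<le> x $ j \<and> x $ j < r $ j}"
  shows "E \<in> lmeasurable" and "measure lebesgue E = (\<Prod>j\<in>UNIV. r $ j - l $ j)"
proof -
  have sub: "box l r \<subseteq> E" "E \<subseteq> cbox l r"
    by (auto simp: E_def mem_box_cart less_imp_le)
  have "E = (\<Inter>j. {x. l $ j \<le> x $ j} \<inter> {x. x $ j < r $ j})"
    by (auto simp: E_def)
  also have "\<dots> \<in> sets borel"
    by (intro sets.finite_INT sets.Int borel_closed borel_open closed_Collect_le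
        open_Collect_less continuous_intros) auto
  finally have "E \<in> sets borel" .
  then have E: "E \<in> sets lebesgue" by simp
  show lm: "E \<in> lmeasurable"
    by (rule bounded_set_imp_lmeasurable[OF bounded_subset[OF bounded_cbox sub(2)] E])
  have "measure lebesgue (box l r) \<le> measure lebesgue E"
    by (rule measure_mono_fmeasurable[OF sub(1) _ lm]) simp
  moreover have "measure lebesgue E \<le> measure lebesgue (cbox l r)"
    by (rule measure_mono_fmeasurable[OF sub(2) E]) simp
  moreover have "measure lebesgue (box l r) = measure lebesgue (cbox l r)"
    by (simp add: measure_lborel_box_eq measure_lborel_cbox_eq)
  moreover have "measure lebesgue (cbox l r) = (\<Prod>j\<in>UNIV. r $ j - l $ j)"
    using content_cbox_cart[of l r] lr by (auto simp: interval_eq_empty_cart not_less)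
  ultimately show "measure lebesgue E = (\<Prod>j\<in>UNIV. r $ j - l $ j)" by linarith
qed

lemma cell_lebesgue:
  fixes k :: "'d::finite \<Rightarrow> nat"
  assumes "0 < b"
  shows "(cell b k a :: (real ^ 'd) set) \<in> lmeasurable"
    and "measure lebesgue (cell b k a :: (real ^ 'd) set) = 1 / real b ^ (\<Sum>j\<in>UNIV. k j)"
proof -
  let ?l = "\<chi> j. real (a j) / real b ^ k j" and ?r = "\<chi> j. (real (a j) + 1) / real b ^ k j"
  have le: "?l $ j \<le> ?r $ j" for j by (simp add: divide_right_mono)
  have eq: "cell b k a = {x. \<forall>j. ?l $ j \<le> x $ j \<and> x $ j < ?r $ j}" by (simp add: cell_def)
  show "(cell b k a :: (real ^ 'd) set) \<in> lmeasurable"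
    unfolding eq by (rule half_open_box_lebesgue(1)[OF le])
  have "measure lebesgue (cell b k a :: (real ^ 'd) set) = (\<Prod>j\<in>UNIV. ?r $ j - ?l $ j)"
    unfolding eq by (rule half_open_box_lebesgue(2)[OF le])
  also have "\<dots> = (\<Prod>j\<in>UNIV. 1 / real b ^ k j)"
    by (simp add: diff_divide_distrib[symmetric])
  also have "\<dots> = 1 / real b ^ (\<Sum>j\<in>UNIV. k j)"
    by (simp add: prod_dividef power_sum)
  finally show "measure lebesgue (cell b k a :: (real ^ 'd) set) = 1 / real b ^ (\<Sum>j\<in>UNIV. k j)" .
qed

lemma connected_cell: "connected (cell b k a)"
proof -
  have "is_interval (cell b k a)"
    unfolding is_interval_cart cell_def by (smt (verit) mem_Collect_eq)
  then show ?thesis by (rule is_interval_connected)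
qed

text \<open>In floor form the index \<open>a\<close> is a function of the point \<open>x\<close>,
  which yields both the covering of the cube and the disjointness of the cells.\<close>

lemma mem_cell_iff:
  assumes "0 < b"
  shows "x \<in> cell b k a \<longleftrightarrow> (\<forall>j. \<lfloor>x $ j * real b ^ k j\<rfloor> = int (a j))"
  using assms by (simp add: cell_def floor_eq_iff field_simps)

lemma unit_cube_eq_cells:
  fixes k :: "'d::finite \<Rightarrow> nat"
  assumes "0 < b"
  shows "unit_cube = (\<Union>a\<in>{a. \<forall>j. a j < b ^ k j}. cell b k a)"
proof (intro set_eqI iffI)
  fix x :: "real ^ 'd"
  assume x: "x \<in> unit_cube"
  let ?a = "\<lambda>j. nat \<lfloor>x $ j * real b ^ k j\<rfloor>"
  have "?a j < b ^ k j" for j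
  proof -
    have "x $ j * real b ^ k j < real (b ^ k j)"
      using x assms by (simp add: unit_cube_def)
    then show ?thesis
      using x by (simp add: unit_cube_def nat_less_iff floor_less_iff)
  qed
  moreover have "x \<in> cell b k ?a"
    using x by (simp add: mem_cell_iff[OF assms] unit_cube_def)
  ultimately show "x \<in> (\<Union>a\<in>{a. \<forall>j. a j < b ^ k j}. cell b k a)" by blast
next
  fix x :: "real ^ 'd"
  assume "x \<in> (\<Union>a\<in>{a. \<forall>j. a j < b ^ k j}. cell b k a)"
  then obtain a where a: "\<forall>j. a j < b ^ k j" "x \<in> cell b k a" by blast
  have "0 \<le> x $ j \<and> x $ j < 1" for j
  proof -
    \<comment> \<open>A strict inequality between naturals leaves room for the full width of the
      cell, so its right end is at most 1.\<close>
    have "real (a j) + 1 \<le> real (b ^ k j)"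
      using a(1) by (metis Suc_leI of_nat_Suc of_nat_le_iff add.commute)
    then have "(real (a j) + 1) / real b ^ k j \<le> 1" using assms by simp
    moreover have "0 \<le> real (a j) / real b ^ k j" by simp
    ultimately show ?thesis using a(2) unfolding cell_def by (smt (verit) mem_Collect_eq)
  qed
  then show "x \<in> unit_cube" by (simp add: unit_cube_def)
qed

lemma finite_cell_indices: "finite {a :: 'd::finite \<Rightarrow> nat. \<forall>j. a j < n j}"
proof -
  have "{a. \<forall>j. a j < n j} = (\<Pi>\<^sub>E j\<in>UNIV. {..<n j})" by (auto simp: PiE_def)
  then show ?thesis by (simp add: finite_PiE)
qed

lemma disjoint_cells: "0 < b \<Longrightarrow> disjoint_family_on (cell b k) A"
  by (auto simp: disjoint_family_on_def mem_cell_iff)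

lemma unit_cube_lebesgue:
  "(unit_cube :: (real ^ 'd) set) \<in> lmeasurable" "measure lebesgue (unit_cube :: (real ^ 'd) set) = 1"
proof -
  \<comment> \<open>With all exponents zero the grid has a single cell.\<close>
  have "(unit_cube :: (real ^ 'd) set) = cell 1 (\<lambda>_. 0) (\<lambda>_. 0)"
    by (simp add: unit_cube_def cell_def)
  then show "(unit_cube :: (real ^ 'd) set) \<in> lmeasurable" "measure lebesgue (unit_cube :: (real ^ 'd) set) = 1"
    using cell_lebesgue[of 1 "\<lambda>_::'d. 0" "\<lambda>_. 0"] by simp_all
qed

lemma norm_diff_cell:
  fixes x y :: "real ^ 'd"
  assumes "x \<in> cell b k a" "y \<in> cell b k a" and s: "\<And>j. 1 / real b ^ k j \<le> s"
  shows "norm (x - y) \<le> sqrt (real CARD('d)) * s"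
proof -
  \<comment> \<open>Here \<open>undefined\<close> is just some coordinate.\<close>
  have "0 \<le> s" using s[of undefined] by (smt (verit) divide_nonneg_nonneg of_nat_0_le_iff zero_le_power)
  have "\<bar>(x - y) $ j\<bar> \<le> s" for j
  proof -
    have "(real (a j) + 1) / real b ^ k j = real (a j) / real b ^ k j + 1 / real b ^ k j"
      by (rule add_divide_distrib)
    then show ?thesis using assms(1,2) s[of j] unfolding cell_def
      by (smt (verit) mem_Collect_eq vector_minus_component)
  qed
  then have "(norm ((x - y) $ j))\<^sup>2 \<le> s\<^sup>2" for j
    by (metis \<open>0 \<le> s\<close> power_mono abs_ge_zero real_norm_def)
  then have "(\<Sum>j\<in>UNIV. (norm ((x - y) $ j))\<^sup>2) \<le> real CARD('d) * s\<^sup>2"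
    by (intro sum_bounded_above) auto
  then have "norm (x - y) \<le> sqrt (real CARD('d) * s\<^sup>2)"
    unfolding norm_vec_def L2_set_def by (rule real_sqrt_le_mono)
  then show ?thesis using \<open>0 \<le> s\<close> by (simp add: real_sqrt_mult)
qed

section \<open>Parallel bodies, side lengths and the discrepancy of a net\<close>

text \<open>The parallel body is the Minkowski sum of \<open>A\<close> and a closed ball.
  Compactness makes it measurable with finite measure.\<close>

lemma compact_parallel_body:
  assumes "compact A"
  shows "compact (parallel_body A \<epsilon>)"
proof -
  have eq: "parallel_body A \<epsilon> = {x + y |x y. x \<in> A \<and> y \<in> cball 0 \<epsilon>}"
  proof (intro set_eqI iffI)
    fix z assume "z \<in> parallel_body A \<epsilon>"
    then obtain y where "y \<in> A" "norm (z - y) \<le> \<epsilon>" by (auto simp: parallel_body_def)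
    then show "z \<in> {x + y |x y. x \<in> A \<and> y \<in> cball 0 \<epsilon>}"
      by (intro CollectI exI[of _ y] exI[of _ "z - y"]) simp
  qed (force simp: parallel_body_def)
  show ?thesis unfolding eq by (rule compact_sums[OF assms compact_cball])
qed

text \<open>Every coordinate gets the quotient, and the remainder is spread as one extra unit over
  that many coordinates. The lower bound controls the longest side of a cell.\<close>

lemma balanced_exponents:
  "\<exists>k :: 'd::finite \<Rightarrow> nat. (\<Sum>j\<in>UNIV. k j) = n \<and> (\<forall>j. n div CARD('d) \<le> k j)"
proof -
  have "n mod CARD('d) \<le> card (UNIV :: 'd set)" by (simp add: less_imp_le)
  then obtain S :: "'d set" where S: "card S = n mod CARD('d)"
    by (meson obtain_subset_with_card_n)
  have "(\<Sum>j\<in>UNIV. n div CARD('d) + of_bool (j \<in> S)) = n"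
    using S by (simp add: sum.distrib)
  then show ?thesis by (intro exI[of _ "\<lambda>j. n div CARD('d) + of_bool (j \<in> S)"]) auto
qed

text \<open>Rounding \<open>n / D\<close> down costs less than 1 in the exponent, hence at most a
  factor \<open>b\<close> in the side length.\<close>

lemma cell_side_bound:
  assumes b: "2 \<le> b" and D: "0 < D" and k: "n div D \<le> k"
  shows "1 / real b ^ k \<le> real b powr (1 - real n / real D)"
proof -
  have "real n / real D - 1 \<le> real k"
  proof -
    have "n < D * (n div D) + D" using D by (metis mult.commute mod_div_mult_eq mod_less_divisor add.commute add_less_cancel_left)
    also have "\<dots> \<le> D * k + D" using k by simp
    finally have "real n \<le> real (D * k + D)" by (simp only: of_nat_le_iff less_imp_le)
    then show ?thesis using D by (simp add: field_simps)
  qed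
  then have "real b powr (- real k) \<le> real b powr (1 - real n / real D)"
    using b by (intro powr_mono) auto
  then show ?thesis using b by (simp add: powr_minus powr_realpow divide_inverse)
qed

text \<open>A cell inside \<open>S\<close> or outside \<open>S\<close> contributes nothing, because both measures give it
  the same mass. A cell meeting both \<open>S\<close> and its complement is connected, so it contains a boundary
  point of \<open>S\<close> and lies in the parallel body as soon as \<open>\<epsilon>\<close> exceeds its diameter.\<close>

lemma net_discrepancy:
  fixes u :: "nat \<Rightarrow> real ^ 'd"
  assumes net: "tms_net b t m u" and b: "2 \<le> b"
    and S: "S \<subseteq> unit_cube" "S \<in> sets lebesgue"
    and \<epsilon>: "sqrt (real CARD('d)) * real b powr (1 - real (m - t) / real CARD('d)) \<le> \<epsilon>"
    and G: "0 \<le> G" "emeasure lebesgue (parallel_body (frontier S) \<epsilon>) \<le> ennreal G"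
  shows "\<bar>(\<Sum>i = 1..b ^ m. of_bool (u i \<in> S)) / real (b ^ m) - measure lebesgue S\<bar> \<le> G"
proof -
  have b0: "0 < b" using b by simp
  have tm: "t \<le> m" and u: "\<And>i. i \<in> {1..b ^ m} \<Longrightarrow> u i \<in> unit_cube"
    using net by (auto simp: tms_net_def)
  \<comment> \<open>Exponents with sum \<open>m - t\<close> give cells of exactly the volume for
    which the net property speaks.\<close>
  obtain k :: "'d \<Rightarrow> nat" where k: "(\<Sum>j\<in>UNIV. k j) = m - t" "\<And>j. (m - t) div CARD('d) \<le> k j"
    using balanced_exponents by blast
  define A where "A = {a. \<forall>j. a j < b ^ k j}"
  define C where "C = (cell b k :: _ \<Rightarrow> (real ^ 'd) set)"
  define w where "w = real b powi (int t - int m)"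
  define P where "P T = (\<Sum>i = 1..b ^ m. of_bool (u i \<in> T)) / real (b ^ m)" for T
  have finA: "finite A" unfolding A_def by (rule finite_cell_indices)
  have disj: "disjoint_family_on C A" unfolding C_def by (rule disjoint_cells[OF b0])
  have cover: "unit_cube = (\<Union>a\<in>A. C a)" unfolding A_def C_def by (rule unit_cube_eq_cells[OF b0])
  have Cm: "C a \<in> lmeasurable" for a unfolding C_def by (rule cell_lebesgue[OF b0])
  have w_eq: "w = real b ^ t / real b ^ m" using b0 by (simp add: w_def power_int_diff)
  have measC: "measure lebesgue (C a) = w" for a
    using b0 tm by (simp add: C_def cell_lebesgue[OF b0] k w_eq power_diff)
  have PC: "P (C a) = w" if "a \<in> A" for a
  proof -
    have "elementary_interval b (C a)"
      using that unfolding elementary_interval_def A_def C_def cell_def by blast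
    then have "card {i \<in> {1..b ^ m}. u i \<in> C a} = b ^ t"
      using net measC[of a] by (simp add: tms_net_def w_def)
    moreover have "(\<Sum>i = 1..b ^ m. of_bool (u i \<in> C a)) = real (card {i \<in> {1..b ^ m}. u i \<in> C a})"
      by (simp add: sum.If_cases Int_def of_bool_def)
    ultimately show ?thesis by (simp add: P_def w_eq)
  qed
  have P_mono: "P T \<le> P U" if "T \<subseteq> U" for T U
    unfolding P_def using that by (intro divide_right_mono sum_mono) (auto simp: of_bool_def)
  have P_nonneg: "0 \<le> P T" for T
    unfolding P_def by (intro divide_nonneg_nonneg sum_nonneg) auto
  \<comment> \<open>Each point of the cube lies in exactly one cell, so the indicator of
    \<open>S\<close> splits over the grid.\<close>
  have ind: "(of_bool (x \<in> S) :: real) = (\<Sum>a\<in>A. of_bool (x \<in> S \<inter> C a))" if x: "x \<in> unit_cube" for x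
  proof -
    obtain a where a: "a \<in> A" "x \<in> C a" using x cover by blast
    have "(\<Sum>c\<in>A. of_bool (x \<in> S \<inter> C c)) = (\<Sum>c\<in>{a}. (of_bool (x \<in> S \<inter> C c) :: real))"
      using finA a disj by (intro sum.mono_neutral_right) (auto simp: disjoint_family_on_def)
    then show ?thesis using a by simp
  qed
  have PS: "P S = (\<Sum>a\<in>A. P (S \<inter> C a))"
  proof -
    have "(\<Sum>i = 1..b ^ m. of_bool (u i \<in> S)) = (\<Sum>i = 1..b ^ m. \<Sum>a\<in>A. (of_bool (u i \<in> S \<inter> C a) :: real))"
      by (rule sum.cong[OF refl]) (rule ind[OF u])
    also have "\<dots> = (\<Sum>a\<in>A. \<Sum>i = 1..b ^ m. of_bool (u i \<in> S \<inter> C a))" by (rule sum.swap)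
    finally show ?thesis unfolding P_def by (simp add: sum_divide_distrib)
  qed
  have SC: "S \<inter> C a \<in> lmeasurable" for a
    using S(2) Cm by (metis fmeasurable_Int_fmeasurable Int_commute)
  have mS: "measure lebesgue S = (\<Sum>a\<in>A. measure lebesgue (S \<inter> C a))"
  proof -
    have "S = (\<Union>a\<in>A. S \<inter> C a)" using S cover by auto
    moreover have "measure lebesgue (\<Union>a\<in>A. S \<inter> C a) = (\<Sum>a\<in>A. measure lebesgue (S \<inter> C a))"
      using disj by (intro measure_UNION_AE[OF finA SC] pairwiseI AE_I2) (auto simp: disjoint_family_on_def disjnt_def)
    ultimately show ?thesis by simp
  qed
  \<comment> \<open>The cells cut by the boundary of \<open>S\<close>, the only ones that contribute
    an error.\<close>
  define M where "M = {a \<in> A. C a \<inter> S \<noteq> {} \<and> C a - S \<noteq> {}}"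
  have finM: "finite M" using finA by (simp add: M_def)
  have cell_bound: "\<bar>P (S \<inter> C a) - measure lebesgue (S \<inter> C a)\<bar> \<le> (if a \<in> M then w else 0)" if a: "a \<in> A" for a
  proof -
    consider "a \<in> M" | "S \<inter> C a = {}" | "S \<inter> C a = C a" using a unfolding M_def by blast
    then show ?thesis
    proof cases
      \<comment> \<open>Both values lie between 0 and \<open>w\<close>, so they differ by at most
        \<open>w\<close>.\<close>
      case 1
      have "P (S \<inter> C a) \<le> w" using P_mono[of "S \<inter> C a" "C a"] PC[OF a] by simp
      moreover have "measure lebesgue (S \<inter> C a) \<le> w"
        using measure_mono_fmeasurable[of "S \<inter> C a" "C a" lebesgue] SC Cm measC[of a] by auto
      ultimately show ?thesis using 1 P_nonneg[of "S \<inter> C a"] measure_nonneg[of lebesgue "S \<inter> C a"]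
        unfolding if_P[OF 1] by linarith
    next
      case 2
      then show ?thesis by (simp add: P_def w_eq)
    next
      case 3
      then show ?thesis by (simp add: PC[OF a] measC w_eq)
    qed
  qed
  have sub: "(\<Union>a\<in>M. C a) \<subseteq> parallel_body (frontier S) \<epsilon>"
  proof
    fix x assume "x \<in> (\<Union>a\<in>M. C a)"
    then obtain a where a: "a \<in> M" "x \<in> C a" by blast
    then obtain y where y: "y \<in> C a" "y \<in> frontier S"
      using connected_Int_frontier[of "C a" S] connected_cell unfolding M_def C_def by blast
    have "norm (x - y) \<le> sqrt (real CARD('d)) * real b powr (1 - real (m - t) / real CARD('d))"
      by (rule norm_diff_cell[OF a(2)[unfolded C_def] y(1)[unfolded C_def]], rule cell_side_bound[OF b _ k(2)]) simp
    then show "x \<in> parallel_body (frontier S) \<epsilon>"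
      using y(2) \<epsilon> unfolding parallel_body_def by force
  qed
  have "bounded S" 
  proof -
    have "unit_cube \<subseteq> cbox (0 :: real ^ 'd) 1"
      by (auto simp: unit_cube_def mem_box_cart less_imp_le)
    then show ?thesis using S(1) bounded_cbox bounded_subset by blast
  qed
  then have cpt: "compact (parallel_body (frontier S) \<epsilon>)"
    by (intro compact_parallel_body compact_frontier_bounded)
  then have pb: "parallel_body (frontier S) \<epsilon> \<in> lmeasurable" by (rule lmeasurable_compact)
  have "(\<Sum>a\<in>M. w) = measure lebesgue (\<Union>a\<in>M. C a)"
  proof -
    have "measure lebesgue (\<Union>a\<in>M. C a) = (\<Sum>a\<in>M. measure lebesgue (C a))"
      using disj by (intro measure_UNION_AE[OF finM Cm] pairwiseI AE_I2) (auto simp: disjoint_family_on_def disjnt_def M_def)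
    then show ?thesis by (simp add: measC)
  qed
  also have "\<dots> \<le> measure lebesgue (parallel_body (frontier S) \<epsilon>)"
    using sub pb finM Cm by (intro measure_mono_fmeasurable) auto
  also have "\<dots> \<le> G"
    unfolding measure_def using G by (metis enn2real_leI)
  finally have MG: "(\<Sum>a\<in>M. w) \<le> G" .
  have "\<bar>P S - measure lebesgue S\<bar> = \<bar>\<Sum>a\<in>A. (P (S \<inter> C a) - measure lebesgue (S \<inter> C a))\<bar>"
    by (simp add: PS mS sum_subtractf)
  also have "\<dots> \<le> (\<Sum>a\<in>A. \<bar>P (S \<inter> C a) - measure lebesgue (S \<inter> C a)\<bar>)" by (rule sum_abs)
  also have "\<dots> \<le> (\<Sum>a\<in>A. if a \<in> M then w else 0)" by (intro sum_mono cell_bound)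
  also have "\<dots> = (\<Sum>a\<in>M. w)"
    using finA by (intro sum.mono_neutral_cong_right) (auto simp: M_def)
  also note MG
  finally show ?thesis unfolding P_def .
qed

section \<open>Growth of a distribution function where its density is bounded below\<close>

lemma set_integral_ge_const:
  fixes f :: "real \<Rightarrow> real"
  assumes "set_integrable lebesgue {x..y} f" "x \<le> y" "\<And>s. s \<in> {x..y} \<Longrightarrow> c \<le> f s"
  shows "c * (y - x) \<le> (LINT s:{x..y}|lebesgue. f s)"
proof -
  have i: "integrable lebesgue (\<lambda>s. indicat_real {x..y} s * c)"
    by (intro integrable_mult_left integrable_real_indicator) (auto simp: emeasure_lborel_Icc_eq)
  have "c * (y - x) = (LINT s|lebesgue. indicat_real {x..y} s * c)"
    using assms(2) by simp
  also have "\<dots> \<le> (LINT s|lebesgue. indicat_real {x..y} s *\<^sub>R f s)"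
    using assms(1,3) i by (intro integral_mono) (auto simp: set_integrable_def indicator_def)
  finally show ?thesis by (simp add: set_lebesgue_integral_def)
qed

text \<open>By continuity \<open>f\<close> stays above \<open>c\<close> on a neighborhood of
  \<open>v\<close>; integrating over \<open>{x..y}\<close> gives linear growth of \<open>F\<close>
  there.\<close>

lemma density_growth:
  assumes "has_density_near F f v" "isCont f v" "c < f v"
  obtains \<eta> where "0 < \<eta>"
    "\<And>x y. v - \<eta> < x \<Longrightarrow> x < y \<Longrightarrow> y < v + \<eta> \<Longrightarrow> c * (y - x) \<le> F y - F x"
proof -
  obtain a e where ae: "a < v" "v < e" and den: "\<And>x y. a < x \<Longrightarrow> x < y \<Longrightarrow> y < e \<Longrightarrow>
      set_integrable lebesgue {x..y} f \<and> F y - F x = (LINT s:{x..y}|lebesgue. f s)"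
    using assms(1) unfolding has_density_near_def by blast
  have "eventually (\<lambda>s. c < f s) (at v)"
    using assms(2,3) by (simp add: isCont_def order_tendstoD)
  then obtain r where r: "0 < r" "\<And>s. s \<noteq> v \<Longrightarrow> dist s v < r \<Longrightarrow> c < f s"
    unfolding eventually_at by blast
  \<comment> \<open>The filter \<open>at v\<close> leaves out \<open>v\<close> itself, where the
    bound is the assumption \<open>c < f v\<close>.\<close>
  have r': "c < f s" if "\<bar>s - v\<bar> < r" for s
    using r(2)[of s] that assms(3) by (cases "s = v") (auto simp: dist_real_def)
  let ?\<eta> = "min r (min (v - a) (e - v))"
  show thesis
  proof (rule that[of ?\<eta>])
    show "0 < ?\<eta>" using r ae by simp
    fix x y assume xy: "v - ?\<eta> < x" "x < y" "y < v + ?\<eta>"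
    then have *: "a < x" "y < e" by auto
    have "c * (y - x) \<le> (LINT s:{x..y}|lebesgue. f s)"
    proof (rule set_integral_ge_const)
      show "set_integrable lebesgue {x..y} f" using den * xy by blast
      fix s assume "s \<in> {x..y}"
      then have "\<bar>s - v\<bar> < r" using xy by auto
      then show "c \<le> f s" using r' by (simp add: less_imp_le)
    qed (use xy in simp)
    then show "c * (y - x) \<le> F y - F x" using den * xy by simp
  qed
qed

section \<open>The law of the output, distribution functions and quantiles\<close>

lemma sublevel_lebesgue:
  assumes "\<phi> \<in> borel_measurable (lebesgue_on unit_cube)"
  shows "sublevel \<phi> x \<in> sets lebesgue"
proof -
  have "{u \<in> space (lebesgue_on unit_cube). \<phi> u \<le> x} \<in> sets (lebesgue_on unit_cube)"
    using assms by (rule borel_measurable_le) simp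
  then have "sublevel \<phi> x \<in> sets (lebesgue_on unit_cube)" by (simp add: sublevel_def)
  then show ?thesis
    using fmeasurableD[OF unit_cube_lebesgue(1)] by (auto simp: sets_restrict_space)
qed

lemma cdf_output_law:
  assumes "\<phi> \<in> borel_measurable (lebesgue_on unit_cube)"
  shows "cdf (output_law \<phi>) x = measure lebesgue (sublevel \<phi> x)"
proof -
  have "cdf (output_law \<phi>) x = measure (lebesgue_on unit_cube) (\<phi> -` {..x} \<inter> space (lebesgue_on unit_cube))"
    unfolding cdf_def output_law_def by (rule measure_distr[OF assms]) simp
  also have "\<phi> -` {..x} \<inter> space (lebesgue_on unit_cube) = sublevel \<phi> x"
    by (auto simp: sublevel_def)
  also have "measure (lebesgue_on unit_cube) (sublevel \<phi> x) = measure lebesgue (sublevel \<phi> x)"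
    using fmeasurableD[OF unit_cube_lebesgue(1)]
    by (intro measure_restrict_space) (auto simp: sublevel_def)
  finally show ?thesis .
qed

lemma real_distribution_output_law:
  fixes \<phi> :: "real ^ 'd \<Rightarrow> real"
  assumes "\<phi> \<in> borel_measurable (lebesgue_on unit_cube)"
  shows "real_distribution (output_law \<phi>)"
proof -
  have "emeasure lebesgue (unit_cube :: (real ^ 'd) set) = 1"
    using unit_cube_lebesgue[where 'd='d] by (metis emeasure_eq_measure2 ennreal_1)
  then have "prob_space (lebesgue_on (unit_cube :: (real ^ 'd) set))"
    using fmeasurableD[OF unit_cube_lebesgue(1)[where 'd='d]]
    by (intro prob_spaceI) (simp add: emeasure_restrict_space)
  then show ?thesis unfolding output_law_def
    by (rule prob_space.real_distribution_distr) (rule assms)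
qed

text \<open>The limits 0 and 1 of the distribution function make the set in \<open>quantile\<close>
  bounded below and nonempty, so \<open>Inf\<close> is a genuine infimum; the rest is
  monotonicity.\<close>

lemma quantile_cdf:
  assumes "real_distribution M" "0 < p" "p < 1"
  shows "x < quantile (cdf M) p \<Longrightarrow> cdf M x < p"
    and "quantile (cdf M) p < x \<Longrightarrow> p \<le> cdf M x"
proof -
  interpret real_distribution M by fact
  have "eventually (\<lambda>x. cdf M x < p) at_bot"
    using cdf_lim_at_bot assms(2) by (rule order_tendstoD)
  then obtain l where l: "cdf M l < p" by (auto simp: eventually_at_bot_linorder)
  have "eventually (\<lambda>x. p < cdf M x) at_top"
    using cdf_lim_at_top_prob assms(3) by (rule order_tendstoD)
  then obtain h where h: "p < cdf M h" by (auto simp: eventually_at_top_linorder)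
  have bdd: "bdd_below {x. p \<le> cdf M x}"
  proof (rule bdd_belowI)
    fix x assume "x \<in> {x. p \<le> cdf M x}"
    then show "l \<le> x" using l cdf_nondecreasing[of x l] by force
  qed
  show "x < quantile (cdf M) p \<Longrightarrow> cdf M x < p"
    unfolding quantile_def using cInf_lower[OF _ bdd, of x] by force
  assume "quantile (cdf M) p < x"
  then obtain y where "p \<le> cdf M y" "y < x"
    unfolding quantile_def using h cInf_lessD[of "{x. p \<le> cdf M x}" x] by (auto intro: less_imp_le)
  then show "p \<le> cdf M x" using cdf_nondecreasing[of y x] by simp
qed

text \<open>By monotonicity \<open>x\<close> is a lower bound of the set in \<open>quantile\<close>,
  and \<open>y\<close> is a member. This serves the empirical distribution function.\<close>

lemma quantile_between:
  assumes "mono F" "F x < p" "p \<le> F y"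
  shows "x \<le> quantile F p" "quantile F p \<le> y"
proof -
  have lb: "x \<le> z" if "z \<in> {z. p \<le> F z}" for z
    using that assms(2) monoD[OF assms(1), of z x] by force
  show "x \<le> quantile F p"
    unfolding quantile_def using assms(3) by (intro cInf_greatest lb) auto
  show "quantile F p \<le> y"
    unfolding quantile_def using assms(3) lb by (intro cInf_lower bdd_belowI[of _ x]) auto
qed

lemma mono_empirical_cdf: "mono (empirical_cdf \<phi> N u)"
  unfolding empirical_cdf_def
  by (intro monoI divide_right_mono sum_mono) (auto simp: of_bool_def)

section \<open>The error bound for the empirical quantile\<close>

text \<open>The quantifier over \<open>u\<close> stands inside the eventuality, so the threshold for
  \<open>m\<close> is uniform over all nets.\<close>

theorem theorem3p6:
  fixes \<phi> :: "real ^ 'd \<Rightarrow> real"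
    and F f g :: "real \<Rightarrow> real"
    and p v \<delta> \<epsilon>\<^sub>0 :: real
    and b t :: nat
  assumes \<phi>: "\<phi> \<in> borel_measurable (lebesgue_on unit_cube)"
    and F: "F = cdf (output_law \<phi>)"
    and p: "0 < p" "p < 1"
    and v: "v = quantile F p"
    and density: "has_density_near F f v" "0 < f v" "isCont f v"
    and g: "\<And>\<epsilon>. 0 < \<epsilon> \<Longrightarrow> 0 < g \<epsilon>" "mono_on {0<..} g" "(g \<longlongrightarrow> 0) (at_right 0)"
    and \<delta>: "0 < \<delta>" and \<epsilon>\<^sub>0: "0 < \<epsilon>\<^sub>0"
    and boundary: "\<And>\<epsilon>. 0 < \<epsilon> \<Longrightarrow> \<epsilon> \<le> \<epsilon>\<^sub>0 \<Longrightarrow>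
      (SUP x\<in>{x. \<bar>x - v\<bar> \<le> \<delta>}. emeasure lebesgue (parallel_body (frontier (sublevel \<phi> x)) \<epsilon>))
        \<le> ennreal (g \<epsilon>)"
    and b: "2 \<le> b"
  shows "\<forall>\<^sub>F m in sequentially. \<forall>u :: nat \<Rightarrow> real ^ 'd. tms_net b t m u \<longrightarrow>
    \<bar>quantile (empirical_cdf \<phi> (b ^ m) u) p - v\<bar>
      \<le> 2 * g (sqrt (real CARD('d)) * real b powr (1 + real t / real CARD('d))
               * real (b ^ m) powr (- 1 / real CARD('d))) / f v"
proof -
  let ?D = "real CARD('d)"
  define e where "e m = sqrt ?D * real b powr (1 + real t / ?D) * real (b ^ m) powr (- 1 / ?D)" for m
  have e_pos: "0 < e m" for m using b by (simp add: e_def)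
  have "filterlim (\<lambda>m. real (b ^ m)) at_top sequentially"
    using b filterlim_realpow_sequentially_gt1[of "real b"]
    by (intro filterlim_at_infinity_imp_filterlim_at_top) auto
  then have "((\<lambda>m. real (b ^ m) powr (- 1 / ?D)) \<longlongrightarrow> 0) sequentially"
    by (rule tendsto_neg_powr[rotated]) simp
  then have e_lim: "e \<longlonglongrightarrow> 0"
    unfolding e_def by (rule tendsto_mult_right_zero)
  \<comment> \<open>The limit of \<open>g\<close> is one-sided, so \<open>e\<close> must approach 0
    through positive values.\<close>
  have "filterlim e (at_right 0) sequentially"
    using e_lim e_pos by (intro tendsto_imp_filterlim_at_right) auto
  then have g_lim: "(\<lambda>m. g (e m)) \<longlonglongrightarrow> 0" by (rule filterlim_compose[OF g(3)])
  obtain \<eta> where \<eta>: "0 < \<eta>" "\<And>x y. v - \<eta> < x \<Longrightarrow> x < y \<Longrightarrow> y < v + \<eta> \<Longrightarrow>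
      2 / 3 * f v * (y - x) \<le> F y - F x"
    using density_growth[OF density(1,3), of "2 / 3 * f v"] density(2) by auto
  have "(\<lambda>m. 2 * g (e m) / f v) \<longlonglongrightarrow> 2 * 0 / f v"
    using density(2) by (intro tendsto_intros g_lim) simp
  then have "eventually (\<lambda>m. 2 * g (e m) / f v < min \<delta> \<eta>) sequentially"
    using \<delta> \<eta>(1) by (intro order_tendstoD) auto
  moreover have "eventually (\<lambda>m. e m < \<epsilon>\<^sub>0) sequentially"
    using e_lim \<epsilon>\<^sub>0 by (rule order_tendstoD)
  ultimately show ?thesis
  proof eventually_elim
    case (elim m)
    define h where "h = 2 * g (e m) / f v"
    \<comment> \<open>The points \<open>v - h\<close> and \<open>v + h\<close> thus lie both where
      the boundary hypothesis applies and where the growth bound holds.\<close>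
    have h: "0 < h" "h < \<delta>" "h < \<eta>" "f v * h = 2 * g (e m)"
      using elim g(1)[OF e_pos[of m]] density(2) by (auto simp: h_def)
    have "\<bar>quantile (empirical_cdf \<phi> (b ^ m) u) p - v\<bar> \<le> h" if net: "tms_net b t m u" for u
    proof -
      have tm: "t \<le> m" using net by (simp add: tms_net_def)
      have "real (b ^ m) powr (- 1 / ?D) = real b powr (- real m / ?D)"
        using b by (simp add: powr_realpow[symmetric] powr_powr)
      \<comment> \<open>The argument of \<open>g\<close> is exactly the bound on the cell diameter:
        the powers of \<open>b\<close> combine to the exponent
        \<open>1 - (m - t) / d\<close>.\<close>
      then have e_eq: "e m = sqrt ?D * real b powr (1 - real (m - t) / ?D)"
        using tm by (simp add: e_def powr_add[symmetric] of_nat_diff diff_divide_distrib diff_diff_eq2)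
      have close: "\<bar>empirical_cdf \<phi> (b ^ m) u x - F x\<bar> \<le> g (e m)" if x: "\<bar>x - v\<bar> \<le> \<delta>" for x
      proof -
        have "emeasure lebesgue (parallel_body (frontier (sublevel \<phi> x)) (e m)) \<le> ennreal (g (e m))"
          using x by (intro order_trans[OF SUP_upper boundary[OF e_pos]]) (use elim in auto)
        then have "\<bar>(\<Sum>i = 1..b ^ m. of_bool (u i \<in> sublevel \<phi> x)) / real (b ^ m)
            - measure lebesgue (sublevel \<phi> x)\<bar> \<le> g (e m)"
          using g(1)[OF e_pos[of m]] e_eq
          by (intro net_discrepancy[OF net b _ sublevel_lebesgue[OF \<phi>]]) (auto simp: sublevel_def)
        \<comment> \<open>The net points lie in the cube, so membership in \<open>sublevel\<close>
          reduces to the inequality.\<close>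
        moreover have "(\<Sum>i = 1..b ^ m. of_bool (u i \<in> sublevel \<phi> x)) = (\<Sum>i = 1..b ^ m. (of_bool (\<phi> (u i) \<le> x) :: real))"
          using net by (intro sum.cong) (auto simp: tms_net_def sublevel_def)
        ultimately show ?thesis by (simp add: empirical_cdf_def F cdf_output_law[OF \<phi>])
      qed
      have q: "\<And>x. x < v \<Longrightarrow> F x < p" "\<And>x. v < x \<Longrightarrow> p \<le> F x"
        using quantile_cdf[OF real_distribution_output_law[OF \<phi>] p] by (auto simp: v F)
      \<comment> \<open>Stepping \<open>h / 8\<close> off \<open>v\<close> avoids having to show \<open>F v = p\<close>, and \<open>2 / 3 * 7 / 8 > 1 / 2\<close>.\<close>
      have "2 / 3 * f v * (7 / 8 * h) \<le> F (v - h / 8) - F (v - h)"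
        using \<eta>(2)[of "v - h" "v - h / 8"] h by (simp add: algebra_simps)
      \<comment> \<open>Since \<open>f v * h = 2 * g (e m)\<close>, the left side above is
        \<open>7 / 6 * g (e m)\<close>, more than the discrepancy \<open>g (e m)\<close>.\<close>
      then have "F (v - h) + g (e m) < p"
        using q(1)[of "v - h / 8"] h g(1)[OF e_pos[of m]] by simp
      then have lower: "empirical_cdf \<phi> (b ^ m) u (v - h) < p"
        using close[of "v - h"] h by simp
      have "2 / 3 * f v * (7 / 8 * h) \<le> F (v + h) - F (v + h / 8)"
        using \<eta>(2)[of "v + h / 8" "v + h"] h by (simp add: algebra_simps)
      then have "p \<le> F (v + h) - g (e m)"
        using q(2)[of "v + h / 8"] h g(1)[OF e_pos[of m]] by simp
      then have upper: "p \<le> empirical_cdf \<phi> (b ^ m) u (v + h)"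
        using close[of "v + h"] h by simp
      show ?thesis
        using quantile_between[OF mono_empirical_cdf lower upper] by simp
    qed
    then show ?case unfolding h_def e_def by blast
  qed
qed

end
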